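(* Let $n\ge 3$ and let $g=\binom{n-1}{2}$ be the genus of the complete graph $K_n$ on $n$ vertices. Then $K_n$ has a divisor of degree $g-1$ and rank at least $\sqrt{g}/4-1$. Furthermore, if $n$ is odd, then $K_n$ has a divisor of degree $g-1$ and rank at least $\sqrt{g}/\sqrt{2}-1$.
   Context: A divisor on a graph $G=(V,E)$ is a formal sum $\sum_{v\in V}a_v(v)$ with $a_v\in\mathbb{Z}$; its degree is $\sum_v a_v$; it is effective if all $a_v\ge 0$. Two divisors are linearly equivalent if their difference is $Q(f)=\sum_{v\in V}\big(\sum_{(u,v)\in E}(f(v)-f(u))\big)(v)$ for some $f:V\to\mathbb{Z}$. The rank of a divisor $D$ is its Baker–Norine rank: $-1$ if $D$ is not linearly equivalent to an effective divisor, and otherwise the largest integer $k\ge 0$ such that $D-E$ is linearly equivalent to an effective divisor for every effective divisor $E$ of degree $k$. *)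

theory Defs
  imports Complex_Main "Graph_Theory.Kuratowski"
begin

text \<open>
  A graph is a symmetric digraph (locale \<^locale>\<open>graph\<close>): an edge between \<open>u\<close> and \<open>v\<close> is a pair of
  opposite arcs, so it contributes exactly one incoming arc to \<open>v\<close>, with tail \<open>u\<close>.  The formal sums
  over the vertices are the integer functions that vanish off the vertex set.
\<close>

definition divisors :: "('a, 'b) pre_digraph \<Rightarrow> ('a \<Rightarrow> int) set" where
  "divisors G = {D. \<forall>v. v \<notin> verts G \<longrightarrow> D v = 0}"

definition deg :: "('a, 'b) pre_digraph \<Rightarrow> ('a \<Rightarrow> int) \<Rightarrow> int" where
  "deg G D = (\<Sum>v\<in>verts G. D v)"

definition effective :: "('a, 'b) pre_digraph \<Rightarrow> ('a \<Rightarrow> int) \<Rightarrow> bool" where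
  "effective G D \<longleftrightarrow> (\<forall>v\<in>verts G. 0 \<le> D v)"

text \<open>
  The values of \<open>f\<close> off the vertex set are irrelevant, and \<open>Q G f\<close> is \<open>0\<close> there (in a well-formed
  graph), since no arc ends outside the vertex set.
\<close>

definition Q :: "('a, 'b) pre_digraph \<Rightarrow> ('a \<Rightarrow> int) \<Rightarrow> 'a \<Rightarrow> int" where
  "Q G f v = (\<Sum>e\<in>in_arcs G v. f v - f (tail G e))"

definition lin_equiv :: "('a, 'b) pre_digraph \<Rightarrow> ('a \<Rightarrow> int) \<Rightarrow> ('a \<Rightarrow> int) \<Rightarrow> bool" where
  "lin_equiv G D D' \<longleftrightarrow> (\<exists>f. \<forall>v. D v - D' v = Q G f v)"

definition equiv_effective :: "('a, 'b) pre_digraph \<Rightarrow> ('a \<Rightarrow> int) \<Rightarrow> bool" where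
  "equiv_effective G D \<longleftrightarrow> (\<exists>D'\<in>divisors G. effective G D' \<and> lin_equiv G D D')"

text \<open>
  The greatest \<open>k\<close> exists in the second case when the graph is finite and has a vertex: \<open>k = 0\<close>
  qualifies, and no \<open>k > deg G D\<close> does, because linear equivalence preserves the degree.
\<close>

definition rank :: "('a, 'b) pre_digraph \<Rightarrow> ('a \<Rightarrow> int) \<Rightarrow> int" where
  "rank G D =
    (if \<not> equiv_effective G D then - 1
     else int (GREATEST k::nat. \<forall>E\<in>divisors G. effective G E \<and> deg G E = int k \<longrightarrow>
                 equiv_effective G (\<lambda>v. D v - E v)))"

end

theory Submission
  imports Defs
begin

text \<open>
  If every coefficient of a divisor \<open>D\<close> is at least \<open>k \<ge> 0\<close>, then \<open>D - E\<close> is itself effective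
  for every effective \<open>E\<close> of degree \<open>k\<close>, so the rank of \<open>D\<close> is at least \<open>k\<close>.  Hence it suffices
  to spread the degree \<open>g - 1 = n (n - 3) / 2\<close> as evenly as possible over the vertices of
  \<open>K\<^sub>n\<close>: for odd \<open>n\<close> every coefficient is \<open>(n - 3) / 2\<close>, and for even \<open>n\<close> half of the
  coefficients are \<open>(n - 2) / 2\<close> and half are \<open>(n - 4) / 2\<close>.  In both cases the
  smallest coefficient is at least the required bound on the rank.

  The rank is a greatest natural number, so the bound also needs an upper bound on the candidates.
  This comes from invariance of the degree under linear equivalence: the coefficients of \<open>Q(f)\<close>
  add up to \<open>0\<close>, because the contributions of the two opposite arcs of an edge cancel.
\<close>

lemma (in graph) sum_Q_eq_0: "(\<Sum>v\<in>verts G. Q G f v) = 0"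
proof -
  have "(\<Sum>v\<in>verts G. Q G f v) =
      (\<Sum>v\<in>verts G. \<Sum>e\<in>{e \<in> arcs G. head G e = v}. f (head G e) - f (tail G e))"
    unfolding Q_def in_arcs_def by (intro sum.cong refl) auto
  also have "\<dots> = (\<Sum>e\<in>arcs G. f (head G e) - f (tail G e))"
    by (rule sum.group) auto
  also have "\<dots> = (\<Sum>p\<in>arcs_ends G. f (snd p) - f (fst p))"
  proof -
    have "(\<Sum>p\<in>arcs_ends G. f (snd p) - f (fst p)) =
        (\<Sum>e\<in>arcs G. f (snd (arc_to_ends G e)) - f (fst (arc_to_ends G e)))"
      unfolding arcs_ends_def by (simp add: sum.reindex[OF inj_on_arc_to_ends])
    then show ?thesis
      by (simp add: arc_to_ends_def)
  qed
  also have "\<dots> = (\<Sum>p\<in>arcs_ends G. f (snd p)) - (\<Sum>p\<in>arcs_ends G. f (fst p))"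
    by (rule sum_subtractf)
  also have "(\<Sum>p\<in>arcs_ends G. f (snd p)) = (\<Sum>p\<in>arcs_ends G. f (fst p))"
    using sym_arcs unfolding symmetric_def sym_def
    by (intro sum.reindex_bij_witness[where i = prod.swap and j = prod.swap]) auto
  finally show ?thesis
    by simp
qed

lemma (in graph) deg_eq_if_lin_equiv:
  assumes "lin_equiv G D D'"
  shows "deg G D = deg G D'"
proof -
  obtain f where "\<And>v. D v - D' v = Q G f v"
    using assms unfolding lin_equiv_def by blast
  then have "deg G D - deg G D' = 0"
    using sum_Q_eq_0[of f] unfolding deg_def by (simp flip: sum_subtractf)
  then show ?thesis
    by simp
qed

lemma equiv_effective_if_effective:
  assumes "D \<in> divisors G" and "effective G D"
  shows "equiv_effective G D"
proof -
  have "lin_equiv G D D"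
    unfolding lin_equiv_def Q_def by (intro exI[of _ "\<lambda>_. 0"]) simp
  with assms show ?thesis
    unfolding equiv_effective_def by blast
qed

lemma (in graph) deg_nonneg_if_equiv_effective:
  assumes "equiv_effective G D"
  shows "0 \<le> deg G D"
proof -
  obtain D' where "effective G D'" "lin_equiv G D D'"
    using assms unfolding equiv_effective_def by blast
  then show ?thesis
    using deg_eq_if_lin_equiv[of D D'] by (simp add: deg_def effective_def sum_nonneg)
qed

lemma (in graph) rank_ge_min_coefficient:
  fixes k :: nat
  assumes "verts G \<noteq> {}" and "D \<in> divisors G" and ge: "\<And>v. v \<in> verts G \<Longrightarrow> int k \<le> D v"
  shows "int k \<le> rank G D"
proof -
  define P where "P j \<longleftrightarrow> (\<forall>E\<in>divisors G. effective G E \<and> deg G E = int j \<longrightarrow>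
      equiv_effective G (\<lambda>v. D v - E v))" for j :: nat
  have "P k"
    unfolding P_def
  proof (intro ballI impI)
    fix E assume E: "E \<in> divisors G" "effective G E \<and> deg G E = int k"
    have "E v \<le> int k" if "v \<in> verts G" for v
    proof -
      have "E v \<le> deg G E"
        unfolding deg_def using that E by (intro member_le_sum) (auto simp: effective_def)
      with E show ?thesis
        by simp
    qed
    then have "effective G (\<lambda>v. D v - E v)"
      unfolding effective_def using ge by fastforce
    moreover have "(\<lambda>v. D v - E v) \<in> divisors G"
      using E \<open>D \<in> divisors G\<close> by (auto simp: divisors_def)
    ultimately show "equiv_effective G (\<lambda>v. D v - E v)"
      by (intro equiv_effective_if_effective)
  qed
  moreover have "j \<le> nat (deg G D)" if "P j" for j
  proof -
    obtain w where w: "w \<in> verts G"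
      using assms by blast
    \<comment> \<open>Concentrating degree \<open>j\<close> at one vertex gives a test divisor.\<close>
    define E where "E v = (if v = w then int j else 0)" for v
    have E: "E \<in> divisors G" "effective G E" "deg G E = int j"
      using w by (auto simp: E_def divisors_def effective_def deg_def)
    then have "0 \<le> deg G (\<lambda>v. D v - E v)"
      using that deg_nonneg_if_equiv_effective unfolding P_def by blast
    also have "deg G (\<lambda>v. D v - E v) = deg G D - int j"
      using E(3) by (simp add: deg_def sum_subtractf)
    finally show ?thesis
      by simp
  qed
  ultimately have "k \<le> (GREATEST j. P j)"
    by (rule Greatest_le_nat)
  moreover have "equiv_effective G D"
    using assms
    by (intro equiv_effective_if_effective) (auto simp: effective_def intro: order_trans[OF _ ge])
  ultimately show ?thesis
    unfolding rank_def P_def by simp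
qed

lemma complete_digraph_genus_eq:
  fixes n g :: nat
  assumes "n \<ge> 3" and "g = (n - 1) choose 2"
  shows "2 * int g = (int n - 1) * (int n - 2)"
    and "2 * real g = (real n - 1) * (real n - 2)"
proof -
  obtain m where m: "n = m + 3"
    using assms(1) by (metis add.commute le_Suc_ex)
  have "even ((m + 2) * (m + 1))"
    by simp
  moreover have "g = (m + 2) * (m + 1) div 2"
    by (simp add: assms(2) m choose_two)
  ultimately have g: "2 * g = (m + 2) * (m + 1)"
    by simp
  show "2 * int g = (int n - 1) * (int n - 2)"
    using arg_cong[OF g, of int] by (simp add: m algebra_simps)
  show "2 * real g = (real n - 1) * (real n - 2)"
    using arg_cong[OF g, of real] by (simp add: m algebra_simps)
qed

theorem theorem1p11:
  fixes n g :: nat and G :: "('a, 'b) pre_digraph"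
  assumes "n \<ge> 3"
    and "g = (n - 1) choose 2"
    and "complete_digraph n G"
  shows "(\<exists>D\<in>divisors G. deg G D = int g - 1 \<and>
            real_of_int (rank G D) \<ge> sqrt (real g) / 4 - 1) \<and>
         (odd n \<longrightarrow>
            (\<exists>D\<in>divisors G. deg G D = int g - 1 \<and>
               real_of_int (rank G D) \<ge> sqrt (real g) / sqrt 2 - 1))"
proof -
  interpret graph G
    using assms(3) by (simp add: complete_digraph_def)
  have card: "card (verts G) = n"
    using assms(3) by (simp add: complete_digraph_def)
  then have nonempty: "verts G \<noteq> {}"
    using assms(1) by auto
  note genus = complete_digraph_genus_eq[OF assms(1,2)]
  show ?thesis
  proof (cases "odd n")
    case True
    then obtain m where m: "n = 2 * m + 3"
      using assms(1) by (metis add.commute le_Suc_ex even_add odd_numeral evenE)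
    define D where "D v = (if v \<in> verts G then int m else 0)" for v
    have D: "D \<in> divisors G"
      by (simp add: D_def divisors_def)
    have "deg G D = int n * int m"
      by (simp add: deg_def D_def card)
    then have deg: "deg G D = int g - 1"
      using genus(1) by (simp add: m algebra_simps)
    have "int m \<le> rank G D"
      using nonempty D by (intro rank_ge_min_coefficient) (auto simp: D_def)
    then have rank: "real m \<le> real_of_int (rank G D)"
      by linarith
    have strong: "sqrt (real g) / sqrt 2 \<le> real m + 1"
    proof -
      have "real g / 2 \<le> (real m + 1)\<^sup>2"
        using genus(2) by (simp add: m power2_eq_square algebra_simps)
      then show ?thesis
        by (simp add: real_le_lsqrt flip: real_sqrt_divide)
    qed
    have "sqrt (real g) / 4 \<le> sqrt (real g) / sqrt 2"
      by (intro divide_left_mono) (auto intro: real_le_lsqrt)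
    with strong rank have "sqrt (real g) / 4 - 1 \<le> real_of_int (rank G D)"
      by linarith
    moreover have "sqrt (real g) / sqrt 2 - 1 \<le> real_of_int (rank G D)"
      using strong rank by linarith
    ultimately show ?thesis
      using D deg by blast
  next
    case False
    then obtain m where m: "n = 2 * m + 4"
    proof -
      obtain j where "n = 2 * j"
        using False by (auto elim: evenE)
      then show ?thesis
        using assms(1) by (intro that[of "j - 2"]) simp
    qed
    obtain A where A: "A \<subseteq> verts G" "card A = m + 2"
      using obtain_subset_with_card_n[of "m + 2" "verts G"] card m by auto
    define D where "D v = (if v \<in> verts G then int m else 0) + (if v \<in> A then 1 else 0)" for v
    have D: "D \<in> divisors G"
      using A(1) by (auto simp: D_def divisors_def)
    have "deg G D = int n * int m + int (card A)"
      using A(1) by (simp add: deg_def D_def card sum.distrib Int_absorb1 flip: sum.inter_restrict)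
    then have deg: "deg G D = int g - 1"
      using genus(1) by (simp add: m A algebra_simps)
    have "int m \<le> rank G D"
      using nonempty D by (intro rank_ge_min_coefficient) (auto simp: D_def)
    then have rank: "real m \<le> real_of_int (rank G D)"
      by linarith
    have "2 * real g = 4 * (real m * real m) + 10 * real m + 6"
      using genus(2) by (simp add: m algebra_simps)
    moreover have "(4 * (real m + 1))\<^sup>2 = 16 * (real m * real m) + 32 * real m + 16"
      by (simp add: power2_eq_square algebra_simps)
    moreover have "0 \<le> real m * real m"
      by simp
    ultimately have "real g \<le> (4 * (real m + 1))\<^sup>2"
      by linarith
    then have "sqrt (real g) \<le> 4 * (real m + 1)"
      by (intro real_le_lsqrt) auto
    then show ?thesis
      using D deg rank False by (intro conjI impI bexI[of _ D]) auto
  qed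
qed

end
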